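(* Let $N\ge 1$. (a) If $b$ is a positive braid on $N$ strands, then its crossing matrix $\mathcal{C}(b)$ belongs to $\mathcal{SR}^+_N$. (b) Conversely, every matrix $A\in\mathcal{SR}^+_N$ is either the crossing matrix of some (perhaps many) positive braid on $N$ strands, or else (and not both) $A$ is virtually totally blocked.
   Context: Braids. $\mathfrak{B}_N$ is the $N$-strand braid group with standard Artin generators $\sigma_1,\dots,\sigma_{N-1}$. Braids are drawn going downward; the product $ab$ is $a$ followed (below) by $b$. Strands are numbered $1,\dots,N$ from left to right by their starting positions. A crossing is positive if the strand that is on the left just before the crossing passes over the one on the right (this is $\sigma_i$, at positions $i,i+1$), and negative if the right strand passes over the left one ($\sigma_i^{-1}$). A braid is positive if it can be represented by a geometric braid with all crossings positive, i.e. it lies in the submonoid generated by $\sigma_1,\dots,\sigma_{N-1}$. Crossing matrix. $\mathcal{C}(b)$ is the $N\times N$ integer matrix with zero diagonal whose $(i,j)$ entry ($i\ne j$) is the number of positive crossings in which strand $i$ passes over strand $j$ minus the number of negative crossings in which strand $i$ passes over strand $j$; it depends only on the braid. Matrices. A square matrix $A=(a_{ij})$ is $T0$ if for all $i<k<j$, $a_{ik}=0$ and $a_{kj}=0$ imply $a_{ij}=0$; it is $T1$ if for all $i<k<j$, $a_{ik}\neq0$ and $a_{kj}\ne0$ imply $a_{ij}\neq0$. An $R$-matrix is a strictly upper triangular matrix with entries in $\{0,1\}$ that is both $T0$ and $T1$. $\mathcal{SR}^+_N$ is the set of $N\times N$ matrices $A$ with non-negative integer entries and zero diagonal that are $T0$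 and can be written $A=S+R$ with $S$ a symmetric integer matrix with zero diagonal and $R$ an $R$-matrix. Left division. For $1\le i<N$ let $\tau_i$ be the transposition of $i$ and $i+1$, and let $t_i$ be the $N\times N$ matrix with entry $1$ at $(i,i+1)$ and $0$ elsewhere. $\tau_i$ is subordinate to $A$ if $a_{i,i+1}\ge 1$. In that case $\tau_i\backslash A$ denotes the matrix obtained from $A-t_i$ by interchanging rows $i$ and $i+1$ and interchanging columns $i$ and $i+1$. For $A\in\mathcal{SR}^+_N$, the left division of $A$ by $\tau_i$ is allowed if $\tau_i$ is subordinate to $A$ and $\tau_i\backslash A\in\mathcal{SR}^+_N$. Blockage. Let $A=(a_{ij})\in\mathcal{SR}^+_N$. A blockage in $A$ is a triple $i<j<k$ with $a_{ik}=a_{ki}=0$ and an integer $b\ne0$ such that either (first type) $a_{ij}=1$, $a_{ji}=0$, $a_{jk}=a_{kj}=b$, or (second type) $a_{ij}=a_{ji}=b$, $a_{jk}=1$, $a_{kj}=0$. The entry at $(i,j)$ in the first type, respectively at $(j,k)$ in the second type, is then called a blocked $R$. A nonzero matrix $A\in\mathcal{SR}^+_N$ is totally blocked if every nonzero entry of its first superdiagonal (positions $(i,i+1)$, $1\le i<N$) is a blocked $R$. A matrix $A\in\mathcal{SR}^+_N$ is virtually totally blocked if every maximal (i.e. non-extendable) sequence of successive allowed left divisions by transpositions $\tau_i$ starting from $A$ (possibly of length zero) terminates in a totally blocked matrix. *)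

theory Defs
  imports "HOL-Algebra.Group" "Jordan_Normal_Form.Column_Operations"
begin

text \<open>Positions, strands and matrix indices run over \<open>0, \<dots>, N - 1\<close>, the index range of the
  matrix library; the Artin generators are \<open>\<sigma>\<^sub>i\<close> with \<open>Suc i < N\<close>.\<close>

section \<open>Braids\<close>

text \<open>The letter \<open>(i, True)\<close> stands for \<open>\<sigma>\<^sub>i\<close> and \<open>(i, False)\<close> for its inverse.\<close>

type_synonym braid_word = "(nat \<times> bool) list"

definition braid_words :: "nat \<Rightarrow> braid_word set" where
  "braid_words N = lists ({i. Suc i < N} \<times> UNIV)"

inductive artin_step :: "nat \<Rightarrow> braid_word \<Rightarrow> braid_word \<Rightarrow> bool" for N where
  cancel: "Suc i < N \<Longrightarrow> u \<in> braid_words N \<Longrightarrow> v \<in> braid_words N \<Longrightarrow>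
    artin_step N (u @ [(i, s), (i, \<not> s)] @ v) (u @ v)"
| commute: "Suc i < j \<Longrightarrow> Suc j < N \<Longrightarrow> u \<in> braid_words N \<Longrightarrow> v \<in> braid_words N \<Longrightarrow>
    artin_step N (u @ [(i, True), (j, True)] @ v) (u @ [(j, True), (i, True)] @ v)"
| braid: "Suc (Suc i) < N \<Longrightarrow> u \<in> braid_words N \<Longrightarrow> v \<in> braid_words N \<Longrightarrow>
    artin_step N (u @ [(i, True), (Suc i, True), (i, True)] @ v)
                 (u @ [(Suc i, True), (i, True), (Suc i, True)] @ v)"

definition artin_rel :: "nat \<Rightarrow> (braid_word \<times> braid_word) set" where
  "artin_rel N = {(u, v). u \<in> braid_words N \<and> v \<in> braid_words N \<and> equivclp (artin_step N) u v}"

definition braid_group :: "nat \<Rightarrow> braid_word set monoid" where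
  "braid_group N =
     \<lparr>carrier = braid_words N // artin_rel N,
      mult = (\<lambda>a b. \<Union>u\<in>a. \<Union>v\<in>b. artin_rel N `` {u @ v}),
      one = artin_rel N `` {[]}\<rparr>"

definition artin_generator :: "nat \<Rightarrow> nat \<Rightarrow> braid_word set" where
  "artin_generator N i = artin_rel N `` {[(i, True)]}"

definition positive_braids :: "nat \<Rightarrow> braid_word set set" where
  "positive_braids N =
     \<Inter> {H. submonoid H (braid_group N) \<and> artin_generator N ` {i. Suc i < N} \<subseteq> H}"


section \<open>The crossing matrix\<close>

text \<open>\<open>p k\<close> is the strand currently at position \<open>k\<close>. At a letter \<open>(i, True)\<close> the left strand
  \<open>p i\<close> passes over \<open>p (Suc i)\<close>; at \<open>(i, False)\<close> the right strand passes over the left one.\<close>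

definition swap_positions :: "nat \<Rightarrow> (nat \<Rightarrow> nat) \<Rightarrow> nat \<Rightarrow> nat" where
  "swap_positions i p = p(i := p (Suc i), Suc i := p i)"

fun crossings :: "(nat \<Rightarrow> nat) \<Rightarrow> braid_word \<Rightarrow> nat \<Rightarrow> nat \<Rightarrow> int" where
  "crossings p [] a b = 0"
| "crossings p ((i, s) # w) a b =
     (if s then of_bool (a = p i \<and> b = p (Suc i)) else - of_bool (a = p (Suc i) \<and> b = p i))
     + crossings (swap_positions i p) w a b"

definition word_crossing_matrix :: "nat \<Rightarrow> braid_word \<Rightarrow> int mat" where
  "word_crossing_matrix N w = mat N N (\<lambda>(a, b). crossings id w a b)"

text \<open>All words representing a braid have the same crossing matrix; see
  \<open>crossing_matrix_class\<close> below.\<close>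

definition crossing_matrix :: "nat \<Rightarrow> braid_word set \<Rightarrow> int mat" where
  "crossing_matrix N b = the_elem (word_crossing_matrix N ` b)"


section \<open>Matrices\<close>

definition T0 :: "int mat \<Rightarrow> bool" where
  "T0 A \<longleftrightarrow> (\<forall>i k j. i < k \<and> k < j \<and> j < dim_row A \<longrightarrow>
     A $$ (i, k) = 0 \<longrightarrow> A $$ (k, j) = 0 \<longrightarrow> A $$ (i, j) = 0)"

definition T1 :: "int mat \<Rightarrow> bool" where
  "T1 A \<longleftrightarrow> (\<forall>i k j. i < k \<and> k < j \<and> j < dim_row A \<longrightarrow>
     A $$ (i, k) \<noteq> 0 \<longrightarrow> A $$ (k, j) \<noteq> 0 \<longrightarrow> A $$ (i, j) \<noteq> 0)"

definition R_matrices :: "nat \<Rightarrow> int mat set" where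
  "R_matrices N = {R \<in> carrier_mat N N.
     (\<forall>i<N. \<forall>j\<le>i. R $$ (i, j) = 0) \<and> (\<forall>i<N. \<forall>j<N. R $$ (i, j) \<in> {0, 1}) \<and> T0 R \<and> T1 R}"

definition SR_plus :: "nat \<Rightarrow> int mat set" where
  "SR_plus N = {A \<in> carrier_mat N N.
     (\<forall>i<N. \<forall>j<N. 0 \<le> A $$ (i, j)) \<and> (\<forall>i<N. A $$ (i, i) = 0) \<and> T0 A \<and>
     (\<exists>S \<in> carrier_mat N N. \<exists>R \<in> R_matrices N.
        transpose_mat S = S \<and> (\<forall>i<N. S $$ (i, i) = 0) \<and> A = S + R)}"


section \<open>Left division\<close>

definition t_mat :: "nat \<Rightarrow> nat \<Rightarrow> int mat" where
  "t_mat N i = mat N N (\<lambda>(r, c). if r = i \<and> c = Suc i then 1 else 0)"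

definition subordinate :: "nat \<Rightarrow> int mat \<Rightarrow> bool" where
  "subordinate i A \<longleftrightarrow> A $$ (i, Suc i) \<ge> 1"

definition left_division :: "nat \<Rightarrow> nat \<Rightarrow> int mat \<Rightarrow> int mat" where
  "left_division N i A = swapcols i (Suc i) (swaprows i (Suc i) (A - t_mat N i))"

definition allowed :: "nat \<Rightarrow> nat \<Rightarrow> int mat \<Rightarrow> bool" where
  "allowed N i A \<longleftrightarrow>
     Suc i < N \<and> A \<in> SR_plus N \<and> subordinate i A \<and> left_division N i A \<in> SR_plus N"

definition division_step :: "nat \<Rightarrow> int mat \<Rightarrow> int mat \<Rightarrow> bool" where
  "division_step N A B \<longleftrightarrow> (\<exists>i. allowed N i A \<and> B = left_division N i A)"


section \<open>Blockage\<close>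

definition blockage1 :: "int mat \<Rightarrow> nat \<Rightarrow> nat \<Rightarrow> nat \<Rightarrow> int \<Rightarrow> bool" where
  "blockage1 A i j k b \<longleftrightarrow> i < j \<and> j < k \<and> k < dim_row A \<and> b \<noteq> 0 \<and>
     A $$ (i, k) = 0 \<and> A $$ (k, i) = 0 \<and>
     A $$ (i, j) = 1 \<and> A $$ (j, i) = 0 \<and> A $$ (j, k) = b \<and> A $$ (k, j) = b"

definition blockage2 :: "int mat \<Rightarrow> nat \<Rightarrow> nat \<Rightarrow> nat \<Rightarrow> int \<Rightarrow> bool" where
  "blockage2 A i j k b \<longleftrightarrow> i < j \<and> j < k \<and> k < dim_row A \<and> b \<noteq> 0 \<and>
     A $$ (i, k) = 0 \<and> A $$ (k, i) = 0 \<and>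
     A $$ (i, j) = b \<and> A $$ (j, i) = b \<and> A $$ (j, k) = 1 \<and> A $$ (k, j) = 0"

definition blocked_R :: "int mat \<Rightarrow> nat \<Rightarrow> nat \<Rightarrow> bool" where
  "blocked_R A r c \<longleftrightarrow> (\<exists>k b. blockage1 A r c k b) \<or> (\<exists>i b. blockage2 A i r c b)"

definition totally_blocked :: "nat \<Rightarrow> int mat \<Rightarrow> bool" where
  "totally_blocked N A \<longleftrightarrow> A \<in> SR_plus N \<and> A \<noteq> 0\<^sub>m N N \<and>
     (\<forall>i. Suc i < N \<and> A $$ (i, Suc i) \<noteq> 0 \<longrightarrow> blocked_R A i (Suc i))"

text \<open>A maximal sequence of allowed left divisions is always finite (\<open>wf_division_step\<close> below), so
  it is a chain of steps from \<open>A\<close> to a matrix \<open>B\<close> that admits no further step.\<close>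

definition virtually_totally_blocked :: "nat \<Rightarrow> int mat \<Rightarrow> bool" where
  "virtually_totally_blocked N A \<longleftrightarrow> A \<in> SR_plus N \<and>
     (\<forall>B. (division_step N)\<^sup>*\<^sup>* A B \<and> (\<nexists>C. division_step N B C) \<longrightarrow> totally_blocked N B)"


section \<open>The braid group is a group and crossing matrices are well defined\<close>

lemma braid_words_simps [simp]:
  "[] \<in> braid_words N"
  "(i, s) # w \<in> braid_words N \<longleftrightarrow> Suc i < N \<and> w \<in> braid_words N"
  "u @ v \<in> braid_words N \<longleftrightarrow> u \<in> braid_words N \<and> v \<in> braid_words N"
  by (auto simp: braid_words_def)

lemma equiv_artin_rel: "equiv (braid_words N) (artin_rel N)"
  by (auto simp: equiv_def refl_on_def sym_def trans_def artin_rel_def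
      intro: equivclp_sym equivclp_trans)

lemma artin_step_append:
  assumes "artin_step N u v" "x \<in> braid_words N" "y \<in> braid_words N"
  shows "artin_step N (x @ u @ y) (x @ v @ y)"
  using assms(1)
proof cases
  case (cancel i a b s)
  with assms(2,3) artin_step.cancel[of i N "x @ a" "b @ y" s] show ?thesis by simp
next
  case (commute i j a b)
  with assms(2,3) artin_step.commute[of i j N "x @ a" "b @ y"] show ?thesis by simp
next
  case (braid i a b)
  with assms(2,3) artin_step.braid[of i N "x @ a" "b @ y"] show ?thesis by simp
qed

lemma equivclp_artin_append:
  assumes "equivclp (artin_step N) u v" "x \<in> braid_words N" "y \<in> braid_words N"
  shows "equivclp (artin_step N) (x @ u @ y) (x @ v @ y)"
  using assms(1)
proof (induction rule: equivclp_induct)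
  case base
  show ?case by simp
next
  case (step v w)
  from step(2) have "equivclp (artin_step N) (x @ v @ y) (x @ w @ y)"
    using artin_step_append[OF _ assms(2,3)] by (meson equivclp_sym r_into_equivclp)
  with step(3) show ?case by (rule equivclp_trans)
qed

lemma artin_rel_append:
  assumes "(u, u') \<in> artin_rel N" "(v, v') \<in> artin_rel N"
  shows "(u @ v, u' @ v') \<in> artin_rel N"
proof -
  have w: "u \<in> braid_words N" "u' \<in> braid_words N" "v \<in> braid_words N" "v' \<in> braid_words N"
    and e: "equivclp (artin_step N) u u'" "equivclp (artin_step N) v v'"
    using assms by (auto simp: artin_rel_def)
  have "equivclp (artin_step N) (u @ v) (u' @ v)"
    using equivclp_artin_append[OF e(1), of "[]" v] w by simp
  moreover have "equivclp (artin_step N) (u' @ v) (u' @ v')"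
    using equivclp_artin_append[OF e(2), of u' "[]"] w by simp
  ultimately show ?thesis using w by (auto simp: artin_rel_def intro: equivclp_trans)
qed

lemma braid_group_mult:
  assumes "u \<in> braid_words N" "v \<in> braid_words N"
  shows "artin_rel N `` {u} \<otimes>\<^bsub>braid_group N\<^esub> artin_rel N `` {v} = artin_rel N `` {u @ v}"
proof -
  have "congruent2 (artin_rel N) (artin_rel N) (\<lambda>u v. artin_rel N `` {u @ v})"
    by (rule congruent2I') (metis artin_rel_append equiv_artin_rel equiv_class_eq)
  from UN_equiv_class2[OF equiv_artin_rel equiv_artin_rel this assms]
  show ?thesis by (simp add: braid_group_def)
qed

lemma artin_rel_inverse:
  assumes "w \<in> braid_words N"
  shows "(rev (map (\<lambda>(i, s). (i, \<not> s)) w) @ w, []) \<in> artin_rel N"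
  using assms
proof (induction w)
  case Nil
  show ?case by (simp add: artin_rel_def)
next
  case (Cons x w)
  obtain i s where x: "x = (i, s)" by (cases x)
  let ?r = "rev (map (\<lambda>(i, s). (i, \<not> s)) w)"
  have w: "w \<in> braid_words N" "Suc i < N" using Cons.prems by (auto simp: x)
  have r: "?r \<in> braid_words N" using Cons.IH[OF w(1)] by (simp add: artin_rel_def)
  from artin_step.cancel[OF w(2) r w(1), of "\<not> s"]
  have "(?r @ [(i, \<not> s), (i, s)] @ w, ?r @ w) \<in> artin_rel N"
    using w r by (auto simp: artin_rel_def)
  moreover have "trans (artin_rel N)" using equiv_artin_rel by (rule equivE)
  ultimately have "(?r @ [(i, \<not> s), (i, s)] @ w, []) \<in> artin_rel N"
    using Cons.IH[OF w(1)] by (blast dest: transD)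
  then show ?case by (simp add: x)
qed

lemma group_braid_group: "group (braid_group N)"
proof (rule groupI)
  have car: "\<exists>u\<in>braid_words N. a = artin_rel N `` {u}" if "a \<in> carrier (braid_group N)" for a
    using that by (auto simp: braid_group_def elim: quotientE)
  have mem: "artin_rel N `` {u} \<in> carrier (braid_group N)" if "u \<in> braid_words N" for u
    using that by (simp add: braid_group_def quotientI)
  have one: "\<one>\<^bsub>braid_group N\<^esub> = artin_rel N `` {[]}" by (simp add: braid_group_def)
  show "\<one>\<^bsub>braid_group N\<^esub> \<in> carrier (braid_group N)" by (simp add: one mem)
  fix a assume "a \<in> carrier (braid_group N)"
  then obtain u where u: "u \<in> braid_words N" "a = artin_rel N `` {u}" using car by blast
  show "\<one>\<^bsub>braid_group N\<^esub> \<otimes>\<^bsub>braid_group N\<^esub> a = a"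
    using braid_group_mult[of "[]" N u] u by (simp add: one)
  let ?r = "rev (map (\<lambda>(i, s). (i, \<not> s)) u)"
  have inv: "(?r @ u, []) \<in> artin_rel N" by (rule artin_rel_inverse[OF u(1)])
  then have r: "?r \<in> braid_words N" by (simp add: artin_rel_def)
  have "artin_rel N `` {?r} \<otimes>\<^bsub>braid_group N\<^esub> a = \<one>\<^bsub>braid_group N\<^esub>"
    using braid_group_mult[OF r u(1)] equiv_class_eq[OF equiv_artin_rel inv] by (simp add: one u)
  with mem[OF r] show "\<exists>c\<in>carrier (braid_group N). c \<otimes>\<^bsub>braid_group N\<^esub> a = \<one>\<^bsub>braid_group N\<^esub>"
    by blast
  fix b assume "b \<in> carrier (braid_group N)"
  then obtain v where v: "v \<in> braid_words N" "b = artin_rel N `` {v}" using car by blast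
  show "a \<otimes>\<^bsub>braid_group N\<^esub> b \<in> carrier (braid_group N)"
    using u v by (simp add: braid_group_mult mem)
  fix c assume "c \<in> carrier (braid_group N)"
  then obtain w where w: "w \<in> braid_words N" "c = artin_rel N `` {w}" using car by blast
  show "a \<otimes>\<^bsub>braid_group N\<^esub> b \<otimes>\<^bsub>braid_group N\<^esub> c = a \<otimes>\<^bsub>braid_group N\<^esub> (b \<otimes>\<^bsub>braid_group N\<^esub> c)"
    using u v w by (simp add: braid_group_mult)
qed

fun final_strands :: "(nat \<Rightarrow> nat) \<Rightarrow> braid_word \<Rightarrow> nat \<Rightarrow> nat" where
  "final_strands p [] = p"
| "final_strands p ((i, s) # w) = final_strands (swap_positions i p) w"

lemma crossings_append:
  "crossings p (u @ v) a b = crossings p u a b + crossings (final_strands p u) v a b"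
  by (induction p u rule: final_strands.induct) auto

lemma swap_positions_apply:
  "swap_positions i p k = (if k = i then p (Suc i) else if k = Suc i then p i else p k)"
  by (simp add: swap_positions_def)

lemma swap_positions_cancel: "swap_positions i (swap_positions i q) = q"
  by (rule ext) (simp add: swap_positions_apply)

lemma swap_positions_commute:
  "Suc i < j \<Longrightarrow>
     swap_positions j (swap_positions i q) = swap_positions i (swap_positions j q)"
  by (rule ext) (simp add: swap_positions_apply)

lemma swap_positions_braid:
  "swap_positions i (swap_positions (Suc i) (swap_positions i q)) =
     swap_positions (Suc i) (swap_positions i (swap_positions (Suc i) q))"
  by (rule ext) (simp add: swap_positions_apply)

lemma crossings_cancel: "crossings q ([(i, s), (i, \<not> s)] @ v) a b = crossings q v a b"
  by (cases s) (simp_all add: swap_positions_cancel swap_positions_apply)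

lemma crossings_commute:
  assumes "Suc i < j"
  shows "crossings q ([(i, True), (j, True)] @ v) a b = crossings q ([(j, True), (i, True)] @ v) a b"
  using assms by (simp add: swap_positions_commute swap_positions_apply)

lemma crossings_braid:
  "crossings q ([(i, True), (Suc i, True), (i, True)] @ v) a b =
     crossings q ([(Suc i, True), (i, True), (Suc i, True)] @ v) a b"
  by (simp add: swap_positions_braid swap_positions_apply)

lemma crossings_artin_step:
  assumes "artin_step N u v"
  shows "crossings p u a b = crossings p v a b"
  using assms
proof cases
  case (cancel i x y s)
  show ?thesis unfolding cancel crossings_append[of p x] crossings_cancel ..
next
  case (commute i j x y)
  show ?thesis
    unfolding commute(1,2) crossings_append[of p x] crossings_commute[OF commute(3)] ..
next
  case (braid i x y)
  show ?thesis unfolding braid crossings_append[of p x] crossings_braid ..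
qed

lemma word_crossing_matrix_artin_rel:
  assumes "(u, v) \<in> artin_rel N"
  shows "word_crossing_matrix N u = word_crossing_matrix N v"
proof -
  have "equivclp (artin_step N) u v" using assms by (simp add: artin_rel_def)
  then have "crossings id u a b = crossings id v a b" for a b
    by (induction rule: equivclp_induct) (auto simp: crossings_artin_step)
  then show ?thesis by (simp add: word_crossing_matrix_def)
qed

lemma crossing_matrix_class:
  assumes "u \<in> braid_words N"
  shows "crossing_matrix N (artin_rel N `` {u}) = word_crossing_matrix N u"
proof -
  have "word_crossing_matrix N ` (artin_rel N `` {u}) = {word_crossing_matrix N u}"
  proof (intro subset_antisym subsetI)
    fix M assume "M \<in> word_crossing_matrix N ` (artin_rel N `` {u})"
    then obtain v where "(u, v) \<in> artin_rel N" "M = word_crossing_matrix N v" by blast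
    then show "M \<in> {word_crossing_matrix N u}"
      using word_crossing_matrix_artin_rel[of u v N] by simp
  next
    fix M assume "M \<in> {word_crossing_matrix N u}"
    with equiv_class_self[OF equiv_artin_rel assms]
    show "M \<in> word_crossing_matrix N ` (artin_rel N `` {u})" by blast
  qed
  then show ?thesis by (simp add: crossing_matrix_def)
qed


section \<open>Sequences of allowed left divisions are finite\<close>

lemma left_division_index:
  assumes "A \<in> carrier_mat N N" "Suc i < N" "r < N" "c < N"
  shows "left_division N i A $$ (r, c) =
    (A - t_mat N i) $$ (Transposition.transpose i (Suc i) r, Transposition.transpose i (Suc i) c)"
  using assms by (simp add: left_division_def t_mat_def Transposition.transpose_def)

lemma wf_division_step: "wfp (division_step N)\<inverse>\<inverse>"
proof -
  let ?I = "{..<N} \<times> {..<N}"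
  define f where "f A = (\<Sum>x\<in>?I. nat (A $$ x))" for A :: "int mat"
  have "f B < f A" if step: "division_step N A B" for A B
  proof -
    obtain i where i: "Suc i < N" and A: "A \<in> SR_plus N" "A $$ (i, Suc i) \<ge> 1"
      and B: "B = left_division N i A"
      using step by (auto simp: division_step_def allowed_def subordinate_def)
    let ?t = "Transposition.transpose i (Suc i)"
    have cA: "A \<in> carrier_mat N N" using A(1) by (simp add: SR_plus_def)
    have t: "?t r < N" if "r < N" for r
      using that i by (auto simp: Transposition.transpose_def)
    have bij: "bij_betw (map_prod ?t ?t) ?I ?I"
      by (rule bij_betw_byWitness[where f' = "map_prod ?t ?t"]) (auto simp: t)
    have "f B = (\<Sum>x\<in>?I. nat ((A - t_mat N i) $$ map_prod ?t ?t x))"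
      unfolding f_def by (rule sum.cong) (auto simp: B left_division_index[OF cA i])
    also have "\<dots> = (\<Sum>x\<in>?I. nat ((A - t_mat N i) $$ x))"
      by (rule sum.reindex_bij_betw[OF bij])
    also have "\<dots> < f A"
      unfolding f_def
    proof (rule sum_strict_mono_ex1)
      show "\<forall>x\<in>?I. nat ((A - t_mat N i) $$ x) \<le> nat (A $$ x)"
        using cA by (auto simp: t_mat_def)
      show "\<exists>x\<in>?I. nat ((A - t_mat N i) $$ x) < nat (A $$ x)"
        by (rule bexI[of _ "(i, Suc i)"]) (use cA i A(2) in \<open>auto simp: t_mat_def\<close>)
    qed simp
    finally show ?thesis .
  qed
  then have "wfp (\<lambda>B A. division_step N A B)"
    by (intro wfp_if_convertible_to_nat[of _ f]) auto
  moreover have "(division_step N)\<inverse>\<inverse> = (\<lambda>B A. division_step N A B)"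
    by (intro ext) (rule conversep_iff)
  ultimately show ?thesis by (simp only:)
qed

end

theory Submission
  imports Defs
begin

text \<open>
  A positive word \<open>\<sigma>\<^sub>i w\<close> and its tail \<open>w\<close> are related on the level of crossing matrices by left
  division: \<open>\<tau>\<^sub>i\<close> applied to the crossing matrix of \<open>\<sigma>\<^sub>i w\<close> gives that of \<open>w\<close>, because deleting the
  first crossing removes one count at \<open>(i, i + 1)\<close> and renames the two strands that it exchanged.
  So everything is governed by how left division by \<open>\<tau>\<^sub>i\<close> interacts with membership in \<open>\<S>\<R>\<^sup>+\<close>, for
  a matrix \<open>A\<close> with \<open>A(i, i + 1) \<ge> 1\<close>.

  The condition that \<open>A\<close> is a symmetric matrix plus an \<open>R\<close>-matrix says that
  \<open>A(i, j) - A(j, i)\<close>, for \<open>i < j\<close>, is the inversion pattern of a permutation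
  (\<open>SR_plus_iff\<close>). Left division composes this permutation with the transposition \<open>\<tau>\<^sub>i\<close>, so it
  neither destroys nor creates this property (\<open>inversion_pattern_twist\<close>). Only \<open>T0\<close> is at stake,
  and only for triples that contain both \<open>i\<close> and \<open>i + 1\<close>, as the order of all other triples is
  preserved. Undoing a division is harmless, as \<open>A(i, i + 1) \<noteq> 0\<close> makes the condition on those
  triples vacuous (\<open>SR_plus_left_divisionD\<close>). Dividing can fail only if such a triple is a
  blockage (\<open>SR_plus_left_divisionI\<close>).

  Part (a) follows by undoing divisions, from the zero matrix upwards. For (b), a matrix is the
  crossing matrix of a positive braid if and only if some sequence of allowed divisions takes it
  to zero (\<open>positive_crossing_matrix_iff\<close>): such a sequence spells out a positive word. A matrix
  in which the divisions get stuck has every nonzero entry of the first superdiagonal blocked, so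
  that it is zero or totally blocked (\<open>stuck_SR_plus\<close>). As the zero matrix is itself stuck, a
  matrix is virtually totally blocked exactly if zero cannot be reached from it.
\<close>

section \<open>Positive braids and positive words\<close>

definition positive_words :: "nat \<Rightarrow> braid_word set" where
  "positive_words N = lists ({i. Suc i < N} \<times> {True})"

lemma positive_words_simps [simp]:
  "[] \<in> positive_words N"
  "(i, s) # w \<in> positive_words N \<longleftrightarrow> Suc i < N \<and> s \<and> w \<in> positive_words N"
  "u @ v \<in> positive_words N \<longleftrightarrow> u \<in> positive_words N \<and> v \<in> positive_words N"
  by (auto simp: positive_words_def)

lemma positive_words_induct [consumes 1, case_names Nil Cons]:
  assumes "w \<in> positive_words N"
    and "P []"
    and "\<And>i w. Suc i < N \<Longrightarrow> w \<in> positive_words N \<Longrightarrow> P w \<Longrightarrow> P ((i, True) # w)"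
  shows "P w"
  using assms(1)
proof (induction w)
  case Nil
  show ?case by (rule assms(2))
next
  case (Cons x w)
  then show ?case using assms(3) by (cases x) auto
qed

lemma positive_words_subset: "w \<in> positive_words N \<Longrightarrow> w \<in> braid_words N"
  by (auto simp: positive_words_def braid_words_def)

lemma positive_braids_eq:
  "positive_braids N = (\<lambda>w. artin_rel N `` {w}) ` positive_words N" (is "_ = ?P")
proof
  have "submonoid ?P (braid_group N)"
  proof
    show "?P \<subseteq> carrier (braid_group N)"
      by (auto simp: braid_group_def positive_words_subset intro: quotientI)
    show "\<one>\<^bsub>braid_group N\<^esub> \<in> ?P"
      by (auto simp: braid_group_def)
    fix x y assume "x \<in> ?P" "y \<in> ?P"
    then obtain u v where "u \<in> positive_words N" "v \<in> positive_words N"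
      "x = artin_rel N `` {u}" "y = artin_rel N `` {v}" by blast
    then show "x \<otimes>\<^bsub>braid_group N\<^esub> y \<in> ?P"
      by (auto simp: braid_group_mult positive_words_subset)
  qed
  moreover have "artin_generator N ` {i. Suc i < N} \<subseteq> ?P"
    by (auto simp: artin_generator_def)
  ultimately show "positive_braids N \<subseteq> ?P"
    unfolding positive_braids_def by blast
  have "artin_rel N `` {w} \<in> H"
    if w: "w \<in> positive_words N"
      and H: "submonoid H (braid_group N)" "artin_generator N ` {i. Suc i < N} \<subseteq> H" for w H
    using w
  proof (induction rule: positive_words_induct)
    case Nil
    show ?case using submonoid.one_closed[OF H(1)] by (simp add: braid_group_def)
  next
    case (Cons i w)
    have "artin_generator N i \<otimes>\<^bsub>braid_group N\<^esub> artin_rel N `` {w} \<in> H"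
      using Cons H by (intro submonoid.m_closed) auto
    moreover have "artin_generator N i \<otimes>\<^bsub>braid_group N\<^esub> artin_rel N `` {w}
        = artin_rel N `` {(i, True) # w}"
      using Cons braid_group_mult[of "[(i, True)]" N w]
      by (simp add: artin_generator_def positive_words_subset)
    ultimately show ?case by simp
  qed
  then show "?P \<subseteq> positive_braids N"
    unfolding positive_braids_def by blast
qed

lemma crossing_matrix_positive_braids:
  "crossing_matrix N ` positive_braids N = word_crossing_matrix N ` positive_words N"
  by (simp add: positive_braids_eq image_image crossing_matrix_class positive_words_subset
      cong: image_cong)


section \<open>Left division removes the first crossing\<close>

abbreviation adj :: "nat \<Rightarrow> nat \<Rightarrow> nat" where
  "adj i \<equiv> Transposition.transpose i (Suc i)"

lemma adj_eq_iff: "adj i r = i \<longleftrightarrow> r = Suc i" "adj i r = Suc i \<longleftrightarrow> r = i"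
  by (auto simp: Transposition.transpose_def)

lemma adj_bound: "Suc i < N \<Longrightarrow> r < N \<Longrightarrow> adj i r < N"
  by (simp add: Transposition.transpose_def)

lemma adj_mono: "r < c \<Longrightarrow> \<not> (r = i \<and> c = Suc i) \<Longrightarrow> adj i r < adj i c"
  by (auto simp: Transposition.transpose_def)

lemma left_division_carrier: "A \<in> carrier_mat N N \<Longrightarrow> left_division N i A \<in> carrier_mat N N"
  by (auto simp: left_division_def t_mat_def)

lemma left_division_entry:
  assumes "A \<in> carrier_mat N N" "Suc i < N" "r < N" "c < N"
  shows "left_division N i A $$ (r, c) = A $$ (adj i r, adj i c) - of_bool (r = Suc i \<and> c = i)"
  using assms by (auto simp: left_division_index t_mat_def Transposition.transpose_def)

text \<open>Since \<open>adj i\<close> is an involution, the entries of \<open>A\<close> can be read off from its quotient.\<close>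

lemma left_division_entry':
  assumes "A \<in> carrier_mat N N" "Suc i < N" "r < N" "c < N"
  shows "A $$ (r, c) = left_division N i A $$ (adj i r, adj i c) + of_bool (r = i \<and> c = Suc i)"
  using left_division_entry[OF assms(1,2) adj_bound[OF assms(2,3)] adj_bound[OF assms(2,4)]]
  by (simp add: adj_eq_iff)

lemma crossings_relabel:
  assumes "inj f"
  shows "crossings (\<lambda>k. f (p k)) w (f a) (f b) = crossings p w a b"
proof (induction w arbitrary: p)
  case Nil
  show ?case by simp
next
  case (Cons x w)
  have "swap_positions i (\<lambda>k. f (p k)) = (\<lambda>k. f (swap_positions i p k))" for i
    by (auto simp: swap_positions_apply)
  with Cons.IH show ?case
    by (cases x) (simp add: inj_eq[OF assms])
qed

text \<open>After the crossing \<open>\<sigma>\<^sub>i\<close> the strands are arranged by the transposition, and the rest of the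
  word sees them as if they were renamed.\<close>

lemma crossings_Cons:
  "crossings id ((i, True) # w) a b =
     crossings id w (adj i a) (adj i b) + of_bool (a = i \<and> b = Suc i)"
proof -
  have "swap_positions i id = (\<lambda>k. adj i (id k))"
    by (auto simp: swap_positions_apply Transposition.transpose_def)
  moreover have "crossings (\<lambda>k. adj i (id k)) w a b = crossings id w (adj i a) (adj i b)"
    using crossings_relabel[of "adj i" id w "adj i a" "adj i b"] by simp
  ultimately show ?thesis by simp
qed

lemma word_crossing_matrix_Cons_iff:
  assumes "A \<in> carrier_mat N N" "Suc i < N"
  shows "word_crossing_matrix N ((i, True) # w) = A \<longleftrightarrow>
    word_crossing_matrix N w = left_division N i A"
proof
  assume A: "word_crossing_matrix N ((i, True) # w) = A"
  show "word_crossing_matrix N w = left_division N i A"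
  proof (rule eq_matI)
    fix r c assume "r < dim_row (left_division N i A)" "c < dim_col (left_division N i A)"
    then have rc: "r < N" "c < N" using left_division_carrier[OF assms(1), of i] by auto
    with adj_bound[OF assms(2)]
    have "A $$ (adj i r, adj i c)
        = crossings id w r c + of_bool (adj i r = i \<and> adj i c = Suc i)"
      unfolding A[symmetric] by (simp add: word_crossing_matrix_def crossings_Cons del: crossings.simps)
    with rc show "word_crossing_matrix N w $$ (r, c) = left_division N i A $$ (r, c)"
      using left_division_entry[OF assms rc]
      by (simp add: word_crossing_matrix_def adj_eq_iff)
  qed (use left_division_carrier[OF assms(1), of i] in \<open>auto simp: word_crossing_matrix_def\<close>)
next
  assume D: "word_crossing_matrix N w = left_division N i A"
  show "word_crossing_matrix N ((i, True) # w) = A"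
  proof (rule eq_matI)
    fix r c assume "r < dim_row A" "c < dim_col A"
    then have rc: "r < N" "c < N" using assms by auto
    then show "word_crossing_matrix N ((i, True) # w) $$ (r, c) = A $$ (r, c)"
      using left_division_entry'[OF assms rc] adj_bound[OF assms(2)]
      by (simp add: D[symmetric] word_crossing_matrix_def crossings_Cons del: crossings.simps)
  qed (use assms(1) in \<open>auto simp: word_crossing_matrix_def\<close>)
qed


section \<open>Inversion patterns\<close>

text \<open>The model is \<open>d i j = 1\<close> if a permutation inverts the pair \<open>i < j\<close>, and \<open>d i j = 0\<close> otherwise.
  For entries 0 and 1 the second condition is \<open>T0\<close> and \<open>T1\<close> in one; it expresses that the
  permuted order is transitive.\<close>

definition inversion_pattern :: "nat \<Rightarrow> (nat \<Rightarrow> nat \<Rightarrow> int) \<Rightarrow> bool" where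
  "inversion_pattern N d \<longleftrightarrow>
     (\<forall>i j. i < j \<and> j < N \<longrightarrow> d i j \<in> {0, 1}) \<and>
     (\<forall>i k j. i < k \<and> k < j \<and> j < N \<longrightarrow> d i k = d k j \<longrightarrow> d i j = d i k)"

lemma inversion_patternD:
  assumes "inversion_pattern N d"
  shows "i < j \<Longrightarrow> j < N \<Longrightarrow> d i j = 0 \<or> d i j = 1"
    and "i < k \<Longrightarrow> k < j \<Longrightarrow> j < N \<Longrightarrow> d i k = d k j \<Longrightarrow> d i j = d i k"
  using assms by (auto simp: inversion_pattern_def)

text \<open>Composing the permutation with the transposition of \<open>i\<close> and \<open>i + 1\<close> complements the entry at
  \<open>(i, i + 1)\<close> and only permutes the others. The condition for a triple that contains both
  \<open>i\<close> and \<open>i + 1\<close> then follows from the old one by contraposition.\<close>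

lemma inversion_pattern_twist:
  assumes d: "inversion_pattern N d" and i: "Suc i < N"
    and flip: "e i (Suc i) = 1 - d i (Suc i)"
    and perm: "\<And>r c. r < c \<Longrightarrow> c < N \<Longrightarrow> \<not> (r = i \<and> c = Suc i) \<Longrightarrow> e r c = d (adj i r) (adj i c)"
  shows "inversion_pattern N e"
  unfolding inversion_pattern_def
proof (intro conjI allI impI)
  fix r c assume rc: "r < c \<and> c < N"
  show "e r c \<in> {0, 1}"
  proof (cases "r = i \<and> c = Suc i")
    case True
    then show ?thesis using inversion_patternD(1)[OF d, of i "Suc i"] i flip by auto
  next
    case False
    then show ?thesis
      using perm[of r c] rc inversion_patternD(1)[OF d adj_mono[of r c i]] adj_bound[OF i, of c]
      by auto
  qed
next
  fix r k c assume rkc: "r < k \<and> k < c \<and> c < N" and eq: "e r k = e k c"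
  consider (low) "r = i" "k = Suc i" | (high) "k = i" "c = Suc i"
    | (other) "\<not> (r = i \<and> k = Suc i)" "\<not> (k = i \<and> c = Suc i)" by blast
  then show "e r c = e r k"
  proof cases
    case low
    then have "e k c = d i c" "e r c = d (Suc i) c"
      using rkc perm[of k c] perm[of r c] by auto
    then show ?thesis
      using low rkc eq flip inversion_patternD(2)[OF d, of i "Suc i" c]
        inversion_patternD(1)[OF d, of i "Suc i"] inversion_patternD(1)[OF d, of i c]
        inversion_patternD(1)[OF d, of "Suc i" c]
      by auto
  next
    case high
    then have "e r k = d r (Suc i)" "e r c = d r i"
      using rkc perm[of r k] perm[of r c] by auto
    then show ?thesis
      using high rkc eq flip inversion_patternD(2)[OF d, of r i "Suc i"]
        inversion_patternD(1)[OF d, of i "Suc i"] inversion_patternD(1)[OF d, of r i]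
        inversion_patternD(1)[OF d, of r "Suc i"]
      by auto
  next
    case other
    then have "\<not> (r = i \<and> c = Suc i)" using rkc by auto
    with other rkc have "e r k = d (adj i r) (adj i k)" "e k c = d (adj i k) (adj i c)"
      "e r c = d (adj i r) (adj i c)"
      using perm by auto
    with other rkc eq show ?thesis
      using inversion_patternD(2)[OF d adj_mono[of r k i] adj_mono[of k c i]] adj_bound[OF i, of c]
      by auto
  qed
qed

definition skew :: "int mat \<Rightarrow> nat \<Rightarrow> nat \<Rightarrow> int" where
  "skew A i j = A $$ (i, j) - A $$ (j, i)"

lemma skew_left_division:
  assumes A: "A \<in> carrier_mat N N" and i: "Suc i < N"
  shows "inversion_pattern N (skew (left_division N i A)) \<longleftrightarrow> inversion_pattern N (skew A)"
proof -
  have flip: "skew (left_division N i A) i (Suc i) = 1 - skew A i (Suc i)"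
    using left_division_entry[OF A i] i by (simp add: skew_def)
  have perm: "skew (left_division N i A) r c = skew A (adj i r) (adj i c)"
    if "r < c" "c < N" "\<not> (r = i \<and> c = Suc i)" for r c
    using left_division_entry[OF A i] that by (auto simp: skew_def)
  have "inversion_pattern N (skew (left_division N i A))" if "inversion_pattern N (skew A)"
    by (rule inversion_pattern_twist[OF that i flip perm])
  moreover have "inversion_pattern N (skew A)" if "inversion_pattern N (skew (left_division N i A))"
    using that
  proof (rule inversion_pattern_twist[OF _ i])
    show "skew A i (Suc i) = 1 - skew (left_division N i A) i (Suc i)"
      using flip by simp
    fix r c assume rc: "r < c" "c < N" "\<not> (r = i \<and> c = Suc i)"
    show "skew A r c = skew (left_division N i A) (adj i r) (adj i c)"
      using left_division_entry'[OF A i, of r c] left_division_entry'[OF A i, of c r] rc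
      by (auto simp: skew_def)
  qed
  ultimately show ?thesis by blast
qed


section \<open>Membership in \<open>\<S>\<R>\<^sup>+\<close>\<close>

text \<open>The summands of \<open>A = S + R\<close> are determined by \<open>A\<close>: below the diagonal \<open>S\<close> agrees with \<open>A\<close>,
  and above it \<open>R\<close> is the difference of mirror entries.\<close>

lemma SR_plus_iff:
  "A \<in> SR_plus N \<longleftrightarrow> A \<in> carrier_mat N N \<and>
     (\<forall>i<N. \<forall>j<N. 0 \<le> A $$ (i, j)) \<and> (\<forall>i<N. A $$ (i, i) = 0) \<and> T0 A \<and>
     inversion_pattern N (skew A)"
proof -
  have "(\<exists>S \<in> carrier_mat N N. \<exists>R \<in> R_matrices N.
        transpose_mat S = S \<and> (\<forall>i<N. S $$ (i, i) = 0) \<and> A = S + R) \<longleftrightarrow>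
      inversion_pattern N (skew A)" (is "?split \<longleftrightarrow> _")
    if A: "A \<in> carrier_mat N N" and diag: "\<forall>i<N. A $$ (i, i) = 0"
  proof
    assume ?split
    then obtain S R where S: "S \<in> carrier_mat N N" "transpose_mat S = S"
      and R: "R \<in> R_matrices N" and AS: "A = S + R" by blast
    have R': "R \<in> carrier_mat N N" "T0 R" "T1 R"
      "\<And>i j. i < N \<Longrightarrow> j \<le> i \<Longrightarrow> R $$ (i, j) = 0"
      "\<And>i j. i < N \<Longrightarrow> j < N \<Longrightarrow> R $$ (i, j) = 0 \<or> R $$ (i, j) = 1"
      using R by (auto simp: R_matrices_def)
    have sym: "S $$ (i, j) = S $$ (j, i)" if "i < N" "j < N" for i j
      using that S by (metis carrier_matD index_transpose_mat(1))
    have skew: "skew A i j = R $$ (i, j)" if "i < j" "j < N" for i j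
      using that sym[of i j] R'(1) R'(4)[of j i] S by (simp add: AS skew_def)
    show "inversion_pattern N (skew A)"
      unfolding inversion_pattern_def
    proof (intro conjI allI impI)
      fix i j assume "i < j \<and> j < N"
      then show "skew A i j \<in> {0, 1}" using skew R'(5)[of i j] by auto
    next
      fix i k j assume *: "i < k \<and> k < j \<and> j < N" "skew A i k = skew A k j"
      then have "R $$ (i, k) = R $$ (k, j)" using skew by simp
      with * R' have "R $$ (i, j) = R $$ (i, k)"
        using R'(5)[of i k] R'(5)[of i j] unfolding T0_def T1_def
        by (metis carrier_matD(1) order_less_trans)
      with * skew show "skew A i j = skew A i k" by simp
    qed
  next
    assume ip: "inversion_pattern N (skew A)"
    define R where "R = mat N N (\<lambda>(i, j). if i < j then skew A i j else 0)"
    define S where "S = mat N N (\<lambda>(i, j). if i < j then A $$ (j, i) else A $$ (i, j))"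
    have ip3: "skew A i k \<noteq> skew A k j \<or> skew A i j = skew A i k"
      if "i < k" "k < j" "j < N" for i k j
      using inversion_patternD(2)[OF ip that] by blast
    have "T0 R"
      unfolding T0_def
    proof (intro allI impI)
      fix i k j
      assume ikj: "i < k \<and> k < j \<and> j < dim_row R" and "R $$ (i, k) = 0" "R $$ (k, j) = 0"
      then have "skew A i k = 0" "skew A k j = 0" by (auto simp: R_def)
      then show "R $$ (i, j) = 0"
        using ip3[of i k j] ikj by (auto simp: R_def)
    qed
    have "T1 R"
      unfolding T1_def
    proof (intro allI impI)
      fix i k j
      assume ikj: "i < k \<and> k < j \<and> j < dim_row R" and "R $$ (i, k) \<noteq> 0" "R $$ (k, j) \<noteq> 0"
      then have "skew A i k = 1" "skew A k j = 1"
        using inversion_patternD(1)[OF ip, of i k] inversion_patternD(1)[OF ip, of k j]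
        by (auto simp: R_def)
      then show "R $$ (i, j) \<noteq> 0"
        using ip3[of i k j] ikj by (auto simp: R_def)
    qed
    with \<open>T0 R\<close> have "R \<in> R_matrices N"
      using inversion_patternD(1)[OF ip] by (auto simp: R_matrices_def R_def)
    moreover have "transpose_mat S = S"
      by (rule eq_matI) (auto simp: S_def not_less dest: order_antisym)
    moreover have "A = S + R"
      by (rule eq_matI) (use A in \<open>auto simp: S_def R_def skew_def\<close>)
    moreover have "S \<in> carrier_mat N N" "\<forall>i<N. S $$ (i, i) = 0"
      using diag by (auto simp: S_def)
    ultimately show ?split by blast
  qed
  then show ?thesis unfolding SR_plus_def by auto
qed

lemma SR_plusD:
  assumes "A \<in> SR_plus N"
  shows "A \<in> carrier_mat N N"
    and "i < N \<Longrightarrow> j < N \<Longrightarrow> 0 \<le> A $$ (i, j)"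
    and "i < N \<Longrightarrow> A $$ (i, i) = 0"
    and "i < k \<Longrightarrow> k < j \<Longrightarrow> j < N \<Longrightarrow> A $$ (i, k) = 0 \<Longrightarrow> A $$ (k, j) = 0 \<Longrightarrow> A $$ (i, j) = 0"
    and "inversion_pattern N (skew A)"
  using assms by (auto simp: SR_plus_iff T0_def)

lemma SR_plus_cases:
  assumes "A \<in> SR_plus N" "i < j" "j < N"
  shows "A $$ (i, j) = A $$ (j, i) \<or> A $$ (i, j) = A $$ (j, i) + 1"
  using inversion_patternD(1)[OF SR_plusD(5)[OF assms(1)] assms(2,3)] by (auto simp: skew_def)

lemma SR_plus_zero: "0\<^sub>m N N \<in> SR_plus N"
  by (simp add: SR_plus_iff T0_def inversion_pattern_def skew_def)

lemma SR_plus_lower_zero: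
  assumes "A \<in> SR_plus N" "i < j" "j < N" "A $$ (i, j) = 0"
  shows "A $$ (j, i) = 0"
  using SR_plus_cases[OF assms(1-3)] SR_plusD(2)[OF assms(1), of j i] assms by auto

text \<open>By \<open>T0\<close> the zeros spread from the first superdiagonal upwards to the whole upper triangle.\<close>

lemma SR_plus_eq_zero:
  assumes A: "A \<in> SR_plus N" and super: "\<And>i. Suc i < N \<Longrightarrow> A $$ (i, Suc i) = 0"
  shows "A = 0\<^sub>m N N"
proof -
  have upper: "A $$ (i, j) = 0" if "i < j" "j < N" for i j
    using that
  proof (induction rule: strict_inc_induct)
    case (base i)
    with super show ?case by simp
  next
    case (step i)
    show ?case
      using SR_plusD(4)[OF A, of i "Suc i" j] super[of i] step by simp
  qed
  have "A $$ (i, j) = 0" if "i < N" "j < N" for i j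
    using upper[of i j] upper[of j i] SR_plus_lower_zero[OF A, of j i] SR_plusD(3)[OF A, of i] that
    by (cases i j rule: linorder_cases) auto
  then show ?thesis
    using SR_plusD(1)[OF A] by (intro eq_matI) auto
qed

text \<open>\<open>T0\<close> of the quotient can only fail at a triple containing \<open>i\<close> and \<open>i + 1\<close>, say
  \<open>i < i + 1 < c\<close>. Then \<open>A(i + 1, i) = A(i, c) = 0\<close> and \<open>A(i + 1, c) \<noteq> 0\<close>. So
  \<open>A(i, i + 1) = 1\<close>, the pair \<open>(i, i + 1)\<close> is inverted and \<open>(i, c)\<close> is not; hence
  \<open>(i + 1, c)\<close> is not inverted, the two entries at \<open>i + 1\<close> and \<open>c\<close> agree, and the triple is a
  blockage of the first type. Triples \<open>r < i < i + 1\<close> give the second type.\<close>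

lemma SR_plus_left_divisionI:
  assumes A: "A \<in> SR_plus N" and i: "Suc i < N" and sub: "A $$ (i, Suc i) \<ge> 1"
    and free: "\<not> blocked_R A i (Suc i)"
  shows "left_division N i A \<in> SR_plus N"
proof -
  let ?D = "left_division N i A"
  note cA = SR_plusD(1)[OF A]
  note cD = left_division_carrier[OF cA, of i]
  note D = left_division_entry[OF cA i]
  note ip = inversion_patternD[OF SR_plusD(5)[OF A], unfolded skew_def]
  have "0 \<le> ?D $$ (r, c)" if "r < N" "c < N" for r c
    using SR_plusD(2)[OF A adj_bound[OF i] adj_bound[OF i], of r c] D[of r c] sub that by auto
  moreover have "?D $$ (r, r) = 0" if "r < N" for r
    using SR_plusD(3)[OF A adj_bound[OF i], of r] D[of r r] that by auto
  moreover have "T0 ?D"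
    unfolding T0_def
  proof (intro allI impI)
    fix r k c
    assume "r < k \<and> k < c \<and> c < dim_row ?D"
    then have rkc: "r < k" "k < c" "c < N" using cD by auto
    assume z: "?D $$ (r, k) = 0" "?D $$ (k, c) = 0"
    consider (low) "r = i" "k = Suc i" | (high) "k = i" "c = Suc i"
      | (other) "\<not> (r = i \<and> k = Suc i)" "\<not> (k = i \<and> c = Suc i)" by blast
    then show "?D $$ (r, c) = 0"
    proof cases
      case low
      with z rkc have a: "A $$ (Suc i, i) = 0" "A $$ (i, c) = 0"
        using D[of r k] D[of k c] by auto
      have one: "A $$ (i, Suc i) = 1"
        using SR_plus_cases[OF A, of i "Suc i"] i sub a by auto
      have ci: "A $$ (c, i) = 0"
        using SR_plus_lower_zero[OF A, of i c] a rkc low by auto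
      have "A $$ (c, Suc i) = A $$ (Suc i, c)"
        using SR_plus_cases[OF A, of "Suc i" c] ip(2)[of i "Suc i" c] rkc low one a ci by auto
      then have "A $$ (Suc i, c) = 0"
        using free rkc low one a ci cA unfolding blocked_R_def blockage1_def by auto
      with low rkc show ?thesis using D[of r c] by auto
    next
      case high
      with z rkc have a: "A $$ (Suc i, i) = 0" "A $$ (r, Suc i) = 0"
        using D[of r k] D[of k c] by auto
      have one: "A $$ (i, Suc i) = 1"
        using SR_plus_cases[OF A, of i "Suc i"] i sub a by auto
      have cr: "A $$ (Suc i, r) = 0"
        using SR_plus_lower_zero[OF A, of r "Suc i"] a rkc high by auto
      have "A $$ (i, r) = A $$ (r, i)"
        using SR_plus_cases[OF A, of r i] ip(2)[of r i "Suc i"] rkc high one a cr by auto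
      then have "A $$ (r, i) = 0"
        using free rkc high one a cr cA unfolding blocked_R_def blockage2_def by auto
      with high rkc show ?thesis using D[of r c] by auto
    next
      case other
      then have "A $$ (adj i r, adj i k) = 0" "A $$ (adj i k, adj i c) = 0"
        using z rkc D[of r k] D[of k c] by auto
      then have "A $$ (adj i r, adj i c) = 0"
        using SR_plusD(4)[OF A adj_mono[of r k i] adj_mono[of k c i] adj_bound[OF i]] rkc other
        by auto
      then show ?thesis using D[of r c] rkc by auto
    qed
  qed
  ultimately show ?thesis
    unfolding SR_plus_iff using cD skew_left_division[OF cA i] SR_plusD(5)[OF A] by auto
qed

text \<open>No blockage can occur in this direction: on a triple containing \<open>i\<close> and \<open>i + 1\<close>, the
  hypothesis of \<open>T0\<close> would include \<open>A(i, i + 1) = 0\<close>.\<close>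

lemma SR_plus_left_divisionD:
  assumes cA: "A \<in> carrier_mat N N" and i: "Suc i < N" and D: "left_division N i A \<in> SR_plus N"
  shows "A \<in> SR_plus N" and "A $$ (i, Suc i) \<ge> 1"
proof -
  note A = left_division_entry'[OF cA i]
  have nonneg: "of_bool (r = i \<and> c = Suc i) \<le> A $$ (r, c)" if "r < N" "c < N" for r c
    using SR_plusD(2)[OF D adj_bound[OF i] adj_bound[OF i], of r c] A[of r c] that by auto
  from nonneg[of i "Suc i"] i show sub: "A $$ (i, Suc i) \<ge> 1" by auto
  have "0 \<le> A $$ (r, c)" if "r < N" "c < N" for r c
    using nonneg[OF that] by (rule order_trans[rotated]) simp
  moreover have "A $$ (r, r) = 0" if "r < N" for r
    using SR_plusD(3)[OF D adj_bound[OF i], of r] A[of r r] that by auto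
  moreover have "T0 A"
    unfolding T0_def
  proof (intro allI impI)
    fix r k c
    assume "r < k \<and> k < c \<and> c < dim_row A"
    then have rkc: "r < k" "k < c" "c < N" using cA by auto
    assume z: "A $$ (r, k) = 0" "A $$ (k, c) = 0"
    with sub have other: "\<not> (r = i \<and> k = Suc i)" "\<not> (k = i \<and> c = Suc i)" by auto
    then have "left_division N i A $$ (adj i r, adj i k) = 0"
      "left_division N i A $$ (adj i k, adj i c) = 0"
      using z rkc A[of r k] A[of k c] by auto
    then have "left_division N i A $$ (adj i r, adj i c) = 0"
      using SR_plusD(4)[OF D adj_mono[of r k i] adj_mono[of k c i] adj_bound[OF i]] rkc other
      by auto
    then show "A $$ (r, c) = 0" using A[of r c] rkc by auto
  qed
  ultimately show "A \<in> SR_plus N"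
    unfolding SR_plus_iff using cA skew_left_division[OF cA i] SR_plusD(5)[OF D] by auto
qed


section \<open>Sequences of divisions and positive words\<close>

lemma division_stepI:
  assumes "A \<in> carrier_mat N N" "Suc i < N" "left_division N i A \<in> SR_plus N"
  shows "division_step N A (left_division N i A)"
  using SR_plus_left_divisionD[OF assms] assms
  by (auto simp: division_step_def allowed_def subordinate_def)

lemma SR_plus_division_steps:
  "(division_step N)\<^sup>*\<^sup>* A B \<Longrightarrow> A \<in> SR_plus N \<Longrightarrow> B \<in> SR_plus N"
  by (induction rule: rtranclp_induct) (auto simp: division_step_def allowed_def)

lemma word_crossing_matrix_Nil: "word_crossing_matrix N [] = 0\<^sub>m N N"
  by (rule eq_matI) (auto simp: word_crossing_matrix_def)

lemma word_crossing_matrix_carrier: "word_crossing_matrix N w \<in> carrier_mat N N"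
  by (simp add: word_crossing_matrix_def)

text \<open>Both claims are carried through the same induction, as each division is allowed because its
  result is again the crossing matrix of a positive word.\<close>

lemma positive_word_reduces:
  assumes "w \<in> positive_words N"
  shows "word_crossing_matrix N w \<in> SR_plus N \<and>
    (division_step N)\<^sup>*\<^sup>* (word_crossing_matrix N w) (0\<^sub>m N N)"
  using assms
proof (induction rule: positive_words_induct)
  case Nil
  show ?case by (simp add: word_crossing_matrix_Nil SR_plus_zero)
next
  case (Cons i w)
  let ?A = "word_crossing_matrix N ((i, True) # w)"
  have carrier: "?A \<in> carrier_mat N N" by (rule word_crossing_matrix_carrier)
  have tail: "word_crossing_matrix N w = left_division N i ?A"
    using word_crossing_matrix_Cons_iff[OF carrier Cons.hyps(1), of w] by simp
  have "left_division N i ?A \<in> SR_plus N" using Cons.IH tail by simp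
  then show ?case
    using SR_plus_left_divisionD(1)[OF carrier Cons.hyps(1)] Cons.IH
      division_stepI[OF carrier Cons.hyps(1)] tail
    by (metis converse_rtranclp_into_rtranclp)
qed

lemma positive_crossing_matrix_iff:
  "A \<in> word_crossing_matrix N ` positive_words N \<longleftrightarrow> (division_step N)\<^sup>*\<^sup>* A (0\<^sub>m N N)"
proof
  assume "A \<in> word_crossing_matrix N ` positive_words N"
  then show "(division_step N)\<^sup>*\<^sup>* A (0\<^sub>m N N)" using positive_word_reduces by blast
next
  assume "(division_step N)\<^sup>*\<^sup>* A (0\<^sub>m N N)"
  then show "A \<in> word_crossing_matrix N ` positive_words N"
  proof (induction rule: converse_rtranclp_induct)
    case base
    show ?case using word_crossing_matrix_Nil by (metis image_eqI positive_words_simps(1))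
  next
    case (step A B)
    then obtain i w where i: "allowed N i A" "B = left_division N i A"
      and w: "w \<in> positive_words N" "word_crossing_matrix N w = B"
      by (auto simp: division_step_def)
    have "A = word_crossing_matrix N ((i, True) # w)"
      using word_crossing_matrix_Cons_iff[of A N i w] i w SR_plusD(1)[of A N]
      by (simp add: allowed_def)
    moreover have "(i, True) # w \<in> positive_words N" using i w by (simp add: allowed_def)
    ultimately show ?case by blast
  qed
qed

lemma stuck_SR_plus:
  assumes A: "A \<in> SR_plus N" and stuck: "\<nexists>B. division_step N A B"
  shows "A = 0\<^sub>m N N \<or> totally_blocked N A"
proof -
  have "blocked_R A i (Suc i)" if i: "Suc i < N" "A $$ (i, Suc i) \<noteq> 0" for i
  proof (rule ccontr)
    assume free: "\<not> blocked_R A i (Suc i)"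
    have "A $$ (i, Suc i) \<ge> 1" using SR_plusD(2)[OF A, of i "Suc i"] i by auto
    then have "left_division N i A \<in> SR_plus N"
      using SR_plus_left_divisionI[OF A i(1) _ free] by simp
    then show False using division_stepI[OF SR_plusD(1)[OF A] i(1)] stuck by blast
  qed
  then show ?thesis using A by (auto simp: totally_blocked_def)
qed

text \<open>The zero matrix is stuck but by definition not totally blocked, so it is the only possible
  end of a maximal sequence of divisions that prevents virtual total blockage.\<close>

lemma virtually_totally_blocked_iff:
  assumes A: "A \<in> SR_plus N"
  shows "virtually_totally_blocked N A \<longleftrightarrow> \<not> (division_step N)\<^sup>*\<^sup>* A (0\<^sub>m N N)"
proof
  have "\<nexists>C. division_step N (0\<^sub>m N N) C"
    by (auto simp: division_step_def allowed_def subordinate_def)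
  then show "virtually_totally_blocked N A \<Longrightarrow> \<not> (division_step N)\<^sup>*\<^sup>* A (0\<^sub>m N N)"
    by (auto simp: virtually_totally_blocked_def totally_blocked_def)
  assume "\<not> (division_step N)\<^sup>*\<^sup>* A (0\<^sub>m N N)"
  then show "virtually_totally_blocked N A"
    using A stuck_SR_plus SR_plus_division_steps[OF _ A]
    unfolding virtually_totally_blocked_def by blast
qed

theorem theorem21:
  fixes N :: nat
  assumes "N \<ge> 1"
  shows "(\<forall>b \<in> positive_braids N. crossing_matrix N b \<in> SR_plus N) \<and>
    (\<forall>A \<in> SR_plus N.
       ((\<exists>b \<in> positive_braids N. crossing_matrix N b = A) \<or> virtually_totally_blocked N A) \<and>
       \<not> ((\<exists>b \<in> positive_braids N. crossing_matrix N b = A) \<and> virtually_totally_blocked N A))"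
proof -
  have realisable: "(\<exists>b \<in> positive_braids N. crossing_matrix N b = A) \<longleftrightarrow>
      (division_step N)\<^sup>*\<^sup>* A (0\<^sub>m N N)" for A
    using crossing_matrix_positive_braids[of N] positive_crossing_matrix_iff[of A N]
    by (metis imageE image_eqI)
  have "crossing_matrix N b \<in> SR_plus N" if "b \<in> positive_braids N" for b
    using that crossing_matrix_positive_braids[of N] positive_word_reduces[of _ N]
    by (metis imageE image_eqI)
  then show ?thesis
    by (auto simp: realisable virtually_totally_blocked_iff)
qed

end
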